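(* For $n\ge 0$ let $T_n(x)=\sum_{k=0}^n \binom{n}{k} n^{n-k} x^k=(x+n)^n\in\mathbb{Z}[x]$ (with $0^0=1$). Then the sequence $(T_n(x))_{n\ge 0}$ is coefficientwise Hankel-totally positive, i.e. the infinite Hankel matrix $\big(T_{n+n'}(x)\big)_{n,n'\ge 0}$ is coefficientwise totally positive.
   Context: A matrix with entries in a polynomial ring $\mathbb{R}[\mathbf{x}]$ is coefficientwise totally positive if every minor is a polynomial with nonnegative coefficients. A sequence $(a_n)_{n\ge0}$ of polynomials is coefficientwise Hankel-totally positive if its Hankel matrix $(a_{n+n'})_{n,n'\ge0}$ is coefficientwise totally positive. *)

theory Defs
  imports "Jordan_Normal_Form.Determinant"
begin

definition coeffwise_nonneg :: "'a::linordered_idom poly \<Rightarrow> bool" where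
  "coeffwise_nonneg p \<longleftrightarrow> (\<forall>k. coeff p k \<ge> 0)"

(* An infinite matrix with rows and columns indexed by the natural numbers is a function of
   two indices. For increasing i and j on {..<r}, this is the r x r minor with rows
   i 0 < ... < i (r-1) and columns j 0 < ... < j (r-1). *)
definition minor :: "(nat \<Rightarrow> nat \<Rightarrow> 'a::comm_ring_1) \<Rightarrow> nat \<Rightarrow> (nat \<Rightarrow> nat) \<Rightarrow> (nat \<Rightarrow> nat) \<Rightarrow> 'a" where
  "minor M r i j = det (mat r r (\<lambda>(p, q). M (i p) (j q)))"

definition coeffwise_totally_positive ::
    "(nat \<Rightarrow> nat \<Rightarrow> 'a::linordered_idom poly) \<Rightarrow> bool" where
  "coeffwise_totally_positive M \<longleftrightarrow>
     (\<forall>r i j. strict_mono_on {..<r} i \<longrightarrow> strict_mono_on {..<r} j \<longrightarrow>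
        coeffwise_nonneg (minor M r i j))"

definition hankel_matrix :: "(nat \<Rightarrow> 'a) \<Rightarrow> nat \<Rightarrow> nat \<Rightarrow> 'a" where
  "hankel_matrix a = (\<lambda>n n'. a (n + n'))"

definition coeffwise_hankel_totally_positive ::
    "(nat \<Rightarrow> 'a::linordered_idom poly) \<Rightarrow> bool" where
  "coeffwise_hankel_totally_positive a \<longleftrightarrow> coeffwise_totally_positive (hankel_matrix a)"

definition T :: "nat \<Rightarrow> int poly" where
  "T n = (\<Sum>k\<le>n. monom (of_nat (n choose k) * of_nat n ^ (n - k)) k)"

lemma T_eq_power: "T n = (monom 1 1 + of_nat n) ^ n"
proof -
  have "(of_nat m :: int poly) ^ j = monom (of_nat m ^ j) 0" for m j :: nat
    by (simp add: of_nat_poly poly_const_pow monom_0)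
  then show ?thesis
    unfolding T_def binomial_ring
    by (intro sum.cong) (simp_all add: monom_power of_nat_monom mult_monom)
qed

end

theory Submission
  imports Defs
begin

text \<open>If \<open>P\<close> is a totally positive matrix, then the sequence of the \<open>(0, 0)\<close> entries of its powers is
  Hankel-totally positive: the matrix of the zeroth rows of the powers and the matrix of their zeroth
  columns are totally positive, and the Hankel matrix is their product. So it suffices to find a
  totally positive \<open>P\<close> with zeroth rows \<open>R n\<close> satisfying \<open>R n 0 = (x + n)\<^sup>n\<close>.

  Encode a row \<open>r\<close> by the polynomial in \<open>y\<close> with coefficients \<open>r k\<close>, and let \<open>R n\<close> be the row of
  \<open>(x + y + n)\<^sup>n\<close>. The binomial matrix acts on rows by \<open>y \<mapsto> y + 1\<close>, the bidiagonal matrix with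
  diagonal \<open>x\<close> and superdiagonal \<open>1\<close> by multiplication by \<open>x + y\<close>, and the matrix of the quotients
  \<open>m! / k!\<close> by the inverse of \<open>1 - d/dy\<close>. Since
  \<open>(1 - d/dy) (x + y + n + 1)\<^sup>n\<^sup>+\<^sup>1 = (x + y) (x + y + n + 1)\<^sup>n\<close>, the product \<open>P\<close> of these three totally
  positive matrices maps \<open>R n\<close> to \<open>R (n + 1)\<close>.\<close>

section \<open>Minors\<close>

lemma minor_leibniz:
  "minor M r i j = (\<Sum>\<sigma> | \<sigma> permutes {0..<r}. signof \<sigma> * (\<Prod>p = 0..<r. M (i p) (j (\<sigma> p))))"
proof -
  have "(\<Prod>p = 0..<r. mat r r (\<lambda>(p, q). M (i p) (j q)) $$ (p, \<sigma> p))
      = (\<Prod>p = 0..<r. M (i p) (j (\<sigma> p)))" if "\<sigma> permutes {0..<r}" for \<sigma>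
    using permutes_in_image[OF that] by (intro prod.cong) auto
  then show ?thesis
    unfolding minor_def by (subst det_def') (auto intro!: sum.cong)
qed

lemma minor_cong:
  assumes "\<And>p q. p < r \<Longrightarrow> q < r \<Longrightarrow> M (i p) (j q) = M' (i' p) (j' q)"
  shows "minor M r i j = minor M' r i' j'"
  unfolding minor_def using assms by (intro arg_cong[where f = det] eq_matI) auto

lemma minor_0 [simp]: "minor M 0 i j = 1"
  by (simp add: minor_leibniz)

lemma minor_transpose: "minor (\<lambda>n k. M k n) r j i = minor M r i j"
  unfolding minor_def
  by (subst det_transpose[symmetric, where n = r]) (auto intro!: arg_cong[where f = det] eq_matI)

lemma minor_permute_rows:
  assumes "\<sigma> permutes {0..<r}"
  shows "minor M r (\<lambda>p. i (\<sigma> p)) j = signof \<sigma> * minor M r i j"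
proof -
  have "det (mat r r (\<lambda>(p, q). mat r r (\<lambda>(p, q). M (i p) (j q)) $$ (\<sigma> p, q)))
      = signof \<sigma> * minor M r i j"
    unfolding minor_def by (intro det_permute_rows assms) simp
  moreover have "mat r r (\<lambda>(p, q). mat r r (\<lambda>(p, q). M (i p) (j q)) $$ (\<sigma> p, q))
      = mat r r (\<lambda>(p, q). M (i (\<sigma> p)) (j q))"
    using permutes_in_image[OF assms] by (intro eq_matI) auto
  ultimately show ?thesis
    by (simp add: minor_def)
qed

lemma minor_eq_0_if_not_inj:
  assumes "\<not> inj_on i {0..<r}"
  shows "minor M r i j = 0"
proof -
  obtain p q where "p < r" "q < r" "p \<noteq> q" "i p = i q"
    using assms by (auto simp: inj_on_def)
  then show ?thesis
    unfolding minor_def by (intro det_identical_rows[of _ r p q]) (auto intro!: eq_vecI)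
qed

text \<open>Peels off the corner entry in the inductions on the size of a minor; the shifted index
  functions inherit strict monotonicity.\<close>

lemma minor_expand_first_row:
  assumes "\<And>q. 0 < q \<Longrightarrow> q \<le> r \<Longrightarrow> M (i 0) (j q) = 0"
  shows "minor M (Suc r) i j = M (i 0) (j 0) * minor M r (\<lambda>p. i (Suc p)) (\<lambda>q. j (Suc q))"
proof -
  let ?A = "mat (Suc r) (Suc r) (\<lambda>(p, q). M (i p) (j q))"
  have "minor M (Suc r) i j = (\<Sum>q<Suc r. ?A $$ (0, q) * cofactor ?A 0 q)"
    unfolding minor_def by (intro laplace_expansion_row) auto
  also have "\<dots> = (\<Sum>q\<in>{0}. ?A $$ (0, q) * cofactor ?A 0 q)"
    using assms by (intro sum.mono_neutral_right) auto
  also have "\<dots> = M (i 0) (j 0) * det (mat_delete ?A 0 0)"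
    by (simp add: cofactor_def)
  also have "mat_delete ?A 0 0 = mat r r (\<lambda>(p, q). M (i (Suc p)) (j (Suc q)))"
    by (intro eq_matI) (auto simp: mat_delete_def)
  finally show ?thesis
    by (simp add: minor_def)
qed

lemma minor_expand_first_col:
  assumes "\<And>p. 0 < p \<Longrightarrow> p \<le> r \<Longrightarrow> M (i p) (j 0) = 0"
  shows "minor M (Suc r) i j = M (i 0) (j 0) * minor M r (\<lambda>p. i (Suc p)) (\<lambda>q. j (Suc q))"
  using minor_expand_first_row[of r "\<lambda>n k. M k n" j i] assms by (simp add: minor_transpose[of M])

text \<open>Adding \<open>- c\<close> times column \<open>l\<close> to column \<open>k\<close> keeps
  the determinant and makes column \<open>k\<close> zero.\<close>

lemma minor_eq_0_if_proportional_cols: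
  assumes "\<And>p. p < r \<Longrightarrow> M (i p) (j k) = c * M (i p) (j l)" "k < r" "l < r" "k \<noteq> l"
  shows "minor M r i j = 0"
proof -
  let ?A = "mat r r (\<lambda>(p, q). M (i p) (j q))"
  have "minor M r i j = det (addcol (- c) k l ?A)"
    unfolding minor_def using assms by simp
  also have "\<dots> = (\<Sum>p<r. addcol (- c) k l ?A $$ (p, k) * cofactor (addcol (- c) k l ?A) p k)"
    using assms by (intro laplace_expansion_column) auto
  also have "\<dots> = 0"
    using assms by (intro sum.neutral) auto
  finally show ?thesis .
qed

text \<open>Expanding the rows of the product multilinearly gives a sum over
  all functions from row positions to summation indices; those that are not injective contribute 0,
  and an injective one is the increasing enumeration of its image composed with a permutation.\<close>

lemma minor_cauchy_binet:
  fixes A B :: "nat \<Rightarrow> nat \<Rightarrow> 'a::comm_ring_1"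
  shows "minor (\<lambda>n k. \<Sum>m<N. A n m * B m k) r i j
    = (\<Sum>K | K \<subseteq> {..<N} \<and> card K = r. minor A r i (\<lambda>p. sorted_list_of_set K ! p)
        * minor B r (\<lambda>p. sorted_list_of_set K ! p) j)"
proof -
  define F where "F = ({0..<r} \<rightarrow>\<^sub>E {..<N})"
  have fin_F: "finite F"
    unfolding F_def by (intro finite_PiE) auto
  \<comment> \<open>\<open>f p\<close> is the summation index chosen in row \<open>p\<close>;
    summing over the permutations gathers the factors from \<open>B\<close> into a minor with rows
    \<open>f\<close>.\<close>
  define w where "w f = (\<Prod>p = 0..<r. A (i p) (f p)) * minor B r f j" for f
  have "minor (\<lambda>n k. \<Sum>m<N. A n m * B m k) r i j
      = (\<Sum>\<sigma> | \<sigma> permutes {0..<r}. signof \<sigma> *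
          (\<Sum>f\<in>F. \<Prod>p = 0..<r. A (i p) (f p) * B (f p) (j (\<sigma> p))))"
    unfolding minor_leibniz F_def by (subst prod_sum_PiE) auto
  also have "\<dots> = (\<Sum>f\<in>F. w f)"
    unfolding w_def minor_leibniz sum_distrib_left prod.distrib
    by (subst sum.swap) (simp add: mult_ac)
  also have "\<dots> = (\<Sum>f | f \<in> F \<and> inj_on f {0..<r}. w f)"
    using fin_F by (intro sum.mono_neutral_right) (auto simp: w_def minor_eq_0_if_not_inj)
  also have "\<dots> = (\<Sum>K | K \<subseteq> {..<N} \<and> card K = r.
      \<Sum>f | f \<in> {f \<in> F. inj_on f {0..<r}} \<and> f ` {0..<r} = K. w f)"
  proof (rule sum.group[symmetric])
    show "finite {K. K \<subseteq> {..<N} \<and> card K = r}"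
      by (rule finite_subset[of _ "Pow {..<N}"]) auto
  qed (use fin_F in \<open>auto simp: F_def card_image\<close>)
  also have "\<dots> = (\<Sum>K | K \<subseteq> {..<N} \<and> card K = r. minor A r i (\<lambda>p. sorted_list_of_set K ! p)
        * minor B r (\<lambda>p. sorted_list_of_set K ! p) j)"
  proof (rule sum.cong[OF refl])
    fix K assume "K \<in> {K. K \<subseteq> {..<N} \<and> card K = r}"
    then have K: "K \<subseteq> {..<N}" "card K = r" "finite K"
      by (auto intro: finite_subset)
    define e where "e p = sorted_list_of_set K ! p" for p
    have e: "bij_betw e {0..<r} K"
      unfolding e_def using bij_betw_nth[of "sorted_list_of_set K" "{0..<r}" K] K
      by (simp add: lessThan_atLeast0)
    define g where "g = inv_into {0..<r} e"
    have g_e: "g (e p) = p" if "p < r" for p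
      using that e by (simp add: g_def bij_betw_def)
    have e_g: "e (g x) = x" if "x \<in> K" for x
      using that e by (simp add: g_def bij_betw_def f_inv_into_f)
    have g: "bij_betw g K {0..<r}"
      unfolding g_def using e by (rule bij_betw_inv_into)
    have "(\<Sum>f | f \<in> {f \<in> F. inj_on f {0..<r}} \<and> f ` {0..<r} = K. w f)
        = (\<Sum>\<sigma> | \<sigma> permutes {0..<r}. w (\<lambda>p. e (\<sigma> p)))"
    \<comment> \<open>With \<open>e\<close> enumerating \<open>K\<close> and \<open>g\<close> its
      inverse, \<open>f\<close> corresponds to the permutation \<open>g\<close> after
      \<open>f\<close>. Outside \<open>{0..<r}\<close> a permutation is the identity while a member
      of \<open>F\<close> is \<open>undefined\<close>, hence the \<open>if\<close> and the
      \<open>restrict\<close>.\<close>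
    proof (rule sum.reindex_bij_witness[where
          i = "\<lambda>\<sigma>. restrict (\<lambda>p. e (\<sigma> p)) {0..<r}" and
          j = "\<lambda>f p. if p \<in> {0..<r} then g (f p) else p"], goal_cases)
      case (1 f)
      then have f: "f \<in> extensional {0..<r}"
        by (simp add: F_def PiE_def)
      have "e (g (f p)) = f p" if "p < r" for p
        using 1 that by (intro e_g) auto
      then show ?case
        using f by (simp add: fun_eq_iff extensional_def)
    next
      case (2 f)
      then have "bij_betw f {0..<r} K"
        by (auto simp: bij_betw_def)
      then have "bij_betw (\<lambda>p. g (f p)) {0..<r} {0..<r}"
        using bij_betw_trans[OF _ g] by (simp add: o_def)
      then have "bij_betw (\<lambda>p. if p \<in> {0..<r} then g (f p) else p) {0..<r} {0..<r}"
        by (rule bij_betw_cong[THEN iffD1, rotated]) auto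
      then show ?case
        by (auto intro!: bij_imp_permutes)
    next
      case (3 \<sigma>)
      then have "\<sigma> permutes {0..<r}"
        by simp
      then have "g (e (\<sigma> p)) = \<sigma> p" if "p < r" for p
        using permutes_in_image[of \<sigma> "{0..<r}" p] that by (intro g_e) simp
      moreover have "\<sigma> p = p" if "\<not> p < r" for p
        using permutes_not_in[OF \<open>\<sigma> permutes {0..<r}\<close>, of p] that by simp
      ultimately show ?case
        by (simp add: fun_eq_iff)
    next
      case (4 \<sigma>)
      then have \<sigma>: "\<sigma> permutes {0..<r}"
        by simp
      have "bij_betw (\<lambda>p. e (\<sigma> p)) {0..<r} K"
        using bij_betw_trans[OF permutes_imp_bij[OF \<sigma>] e] by (simp add: o_def)
      then have "bij_betw (restrict (\<lambda>p. e (\<sigma> p)) {0..<r}) {0..<r} K"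
        by (rule bij_betw_cong[THEN iffD1, rotated]) auto
      then show ?case
        using K(1) by (auto simp: F_def bij_betw_def)
    next
      case (5 f)
      then have *: "e (g (f p)) = f p" if "p < r" for p
        using that by (intro e_g) auto
      show ?case
        unfolding w_def
        by (intro arg_cong2[where f = "(*)"] prod.cong minor_cong) (auto simp: *)
    qed
    \<comment> \<open>Permuting the rows of the minor of \<open>B\<close> costs
      \<open>signof \<sigma>\<close>, which is the sign in the Leibniz formula for the minor of
      \<open>A\<close>.\<close>
    also have "\<dots> = (\<Sum>\<sigma> | \<sigma> permutes {0..<r}.
        (signof \<sigma> * (\<Prod>p = 0..<r. A (i p) (e (\<sigma> p)))) * minor B r e j)"
      by (intro sum.cong refl) (auto simp: w_def minor_permute_rows mult_ac)
    also have "\<dots> = minor A r i e * minor B r e j"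
      by (simp add: minor_leibniz sum_distrib_right)
    finally show "(\<Sum>f | f \<in> {f \<in> F. inj_on f {0..<r}} \<and> f ` {0..<r} = K. w f)
      = minor A r i (\<lambda>p. sorted_list_of_set K ! p)
        * minor B r (\<lambda>p. sorted_list_of_set K ! p) j"
      by (simp add: e_def[abs_def])
  qed
  finally show ?thesis .
qed

section \<open>Coefficientwise total positivity\<close>

lemma coeffwise_nonneg_0 [simp]: "coeffwise_nonneg 0"
  by (simp add: coeffwise_nonneg_def)

lemma coeffwise_nonneg_1 [simp]: "coeffwise_nonneg 1"
  by (simp add: coeffwise_nonneg_def)

lemma coeffwise_nonneg_of_nat [simp]: "coeffwise_nonneg (of_nat n)"
  by (simp add: coeffwise_nonneg_def of_nat_poly coeff_pCons split: nat.split)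

lemma coeffwise_nonneg_mult: "coeffwise_nonneg p \<Longrightarrow> coeffwise_nonneg q \<Longrightarrow> coeffwise_nonneg (p * q)"
  by (auto simp: coeffwise_nonneg_def coeff_mult intro!: sum_nonneg)

lemma coeffwise_nonneg_sum: "(\<And>x. x \<in> S \<Longrightarrow> coeffwise_nonneg (f x)) \<Longrightarrow> coeffwise_nonneg (\<Sum>x\<in>S. f x)"
  by (auto simp: coeffwise_nonneg_def coeff_sum intro!: sum_nonneg)

lemma coeffwise_totally_positiveI:
  "(\<And>r i j. strict_mono_on {..<r} i \<Longrightarrow> strict_mono_on {..<r} j \<Longrightarrow> coeffwise_nonneg (minor M r i j))
    \<Longrightarrow> coeffwise_totally_positive M"
  by (simp add: coeffwise_totally_positive_def)

lemma coeffwise_totally_positiveD: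
  "coeffwise_totally_positive M \<Longrightarrow> strict_mono_on {..<r} i \<Longrightarrow> strict_mono_on {..<r} j
    \<Longrightarrow> coeffwise_nonneg (minor M r i j)"
  by (simp add: coeffwise_totally_positive_def)

lemma strict_mono_on_lessThan_Suc_shift:
  fixes i :: "nat \<Rightarrow> nat"
  shows "strict_mono_on {..<Suc r} i \<Longrightarrow> strict_mono_on {..<r} (\<lambda>p. i (Suc p))"
  by (auto simp: strict_mono_on_def)

lemma strict_mono_on_lessThan_Suc_first:
  fixes i :: "nat \<Rightarrow> nat"
  shows "strict_mono_on {..<Suc r} i \<Longrightarrow> 0 < p \<Longrightarrow> p \<le> r \<Longrightarrow> i 0 < i p"
  by (auto simp: strict_mono_on_def)

text \<open>Fixing \<open>i\<close> and \<open>j\<close> lets this be used inside inductions, where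
  only the minors of a factor with particular rows or columns are known to be nonnegative.\<close>

lemma coeffwise_nonneg_minor_sum_mult:
  assumes "\<And>g. strict_mono_on {..<r} g \<Longrightarrow> coeffwise_nonneg (minor A r i g)"
    and "\<And>g. strict_mono_on {..<r} g \<Longrightarrow> coeffwise_nonneg (minor B r g j)"
  shows "coeffwise_nonneg (minor (\<lambda>n k. \<Sum>m<N. A n m * B m k) r i j)"
  unfolding minor_cauchy_binet
proof (intro coeffwise_nonneg_sum coeffwise_nonneg_mult)
  fix K assume "K \<in> {K. K \<subseteq> {..<N} \<and> card K = r}"
  then have "strict_mono_on {..<r} (\<lambda>p. sorted_list_of_set K ! p)"
    using sorted_wrt_nth_less[OF strict_sorted_list_of_set[of K]]
    by (auto intro!: strict_mono_onI)
  then show "coeffwise_nonneg (minor A r i (\<lambda>p. sorted_list_of_set K ! p))"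
    "coeffwise_nonneg (minor B r (\<lambda>p. sorted_list_of_set K ! p) j)"
    using assms by blast+
qed

section \<open>Products of row-finite matrices\<close>

definition row_finite :: "(nat \<Rightarrow> nat \<Rightarrow> 'a::zero) \<Rightarrow> bool" where
  "row_finite A \<longleftrightarrow> (\<forall>n. finite {m. A n m \<noteq> 0})"

text \<open>Summing over the support of the row of the left factor makes the product of infinite
  matrices a finite sum whenever that factor is row-finite.\<close>

definition row_mult :: "(nat \<Rightarrow> nat \<Rightarrow> 'a::semiring_0) \<Rightarrow> (nat \<Rightarrow> nat \<Rightarrow> 'a) \<Rightarrow> nat \<Rightarrow> nat \<Rightarrow> 'a"
    (infixl "\<star>" 70) where
  "A \<star> B = (\<lambda>n k. \<Sum>m | A n m \<noteq> 0. A n m * B m k)"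

lemma row_finiteI: "(\<And>n m. b n < m \<Longrightarrow> A n m = 0) \<Longrightarrow> row_finite A" for b :: "nat \<Rightarrow> nat"
  unfolding row_finite_def
proof
  fix n assume "\<And>n m. b n < m \<Longrightarrow> A n m = 0"
  then have "{m. A n m \<noteq> 0} \<subseteq> {..b n}"
    using not_le by blast
  then show "finite {m. A n m \<noteq> 0}"
    by (rule finite_subset) simp
qed

lemma row_mult_eq_sum:
  assumes "finite S" "\<And>m. m \<notin> S \<Longrightarrow> A n m = 0"
  shows "(A \<star> B) n k = (\<Sum>m\<in>S. A n m * B m k)"
  unfolding row_mult_def using assms by (intro sum.mono_neutral_left) auto

lemma row_finite_row_mult:
  assumes "row_finite A" "row_finite B"
  shows "row_finite (A \<star> B)"
proof -
  have "{k. (A \<star> B) n k \<noteq> 0} \<subseteq> (\<Union>m\<in>{m. A n m \<noteq> 0}. {k. B m k \<noteq> 0})" for n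
  proof
    fix k assume "k \<in> {k. (A \<star> B) n k \<noteq> 0}"
    then obtain m where "A n m \<noteq> 0" "A n m * B m k \<noteq> 0"
      unfolding row_mult_def by (auto elim: sum.not_neutral_contains_not_neutral)
    then show "k \<in> (\<Union>m\<in>{m. A n m \<noteq> 0}. {k. B m k \<noteq> 0})"
      by auto
  qed
  then show ?thesis
    using assms unfolding row_finite_def by (meson finite_UN_I finite_subset)
qed

lemma row_mult_assoc:
  assumes "row_finite A" "row_finite B"
  shows "A \<star> B \<star> C = A \<star> (B \<star> C)"
proof (intro ext)
  fix n k
  define S where "S = {m. A n m \<noteq> 0}"
  \<comment> \<open>\<open>U\<close> holds every index reachable from row \<open>n\<close> through
    \<open>A\<close> and then \<open>B\<close>; both iterated sums reduce to finite sums over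
    \<open>S\<close> and \<open>U\<close>, which may be swapped.\<close>
  define U where "U = (\<Union>m\<in>S. {l. B m l \<noteq> 0})"
  have fin: "finite S" "finite U"
    using assms by (auto simp: S_def U_def row_finite_def)
  have AB: "(A \<star> B) n l = (\<Sum>m\<in>S. A n m * B m l)" for l
    by (simp add: row_mult_def S_def)
  have "(A \<star> B \<star> C) n k = (\<Sum>l\<in>U. (A \<star> B) n l * C l k)"
  proof (rule row_mult_eq_sum[OF fin(2)])
    fix l assume "l \<notin> U"
    then show "(A \<star> B) n l = 0"
      unfolding AB by (intro sum.neutral) (auto simp: U_def)
  qed
  also have "\<dots> = (\<Sum>m\<in>S. A n m * (\<Sum>l\<in>U. B m l * C l k))"
    by (simp add: AB sum_distrib_left sum_distrib_right mult.assoc sum.swap[of _ U])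
  also have "\<dots> = (\<Sum>m\<in>S. A n m * (B \<star> C) m k)"
  proof (rule sum.cong[OF refl])
    fix m assume "m \<in> S"
    then show "A n m * (\<Sum>l\<in>U. B m l * C l k) = A n m * (B \<star> C) m k"
      by (subst row_mult_eq_sum[OF fin(2)]) (auto simp: U_def)
  qed
  finally show "(A \<star> B \<star> C) n k = (A \<star> (B \<star> C)) n k"
    by (simp add: row_mult_def S_def)
qed

text \<open>A minor involves finitely many rows of \<open>A\<close>, so one bound \<open>N\<close>
  truncates all the sums and Cauchy-Binet applies.\<close>

lemma coeffwise_nonneg_minor_row_mult:
  assumes "row_finite A"
    and "\<And>g. strict_mono_on {..<r} g \<Longrightarrow> coeffwise_nonneg (minor A r i g)"
    and "\<And>g. strict_mono_on {..<r} g \<Longrightarrow> coeffwise_nonneg (minor B r g j)"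
  shows "coeffwise_nonneg (minor (A \<star> B) r i j)"
proof -
  have "finite (\<Union>p<r. {m. A (i p) m \<noteq> 0})"
    using assms(1) by (auto simp: row_finite_def)
  then obtain N where N: "\<And>p m. p < r \<Longrightarrow> A (i p) m \<noteq> 0 \<Longrightarrow> m < N"
    unfolding finite_nat_set_iff_bounded by auto
  have "minor (A \<star> B) r i j = minor (\<lambda>n k. \<Sum>m<N. A n m * B m k) r i j"
    using N by (intro minor_cong row_mult_eq_sum) auto
  then show ?thesis
    using assms(2,3) by (simp add: coeffwise_nonneg_minor_sum_mult)
qed

lemma coeffwise_totally_positive_row_mult:
  assumes "row_finite A" "coeffwise_totally_positive A" "coeffwise_totally_positive B"
  shows "coeffwise_totally_positive (A \<star> B)"
proof (rule coeffwise_totally_positiveI)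
  fix r and i j :: "nat \<Rightarrow> nat"
  assume "strict_mono_on {..<r} i" "strict_mono_on {..<r} j"
  then show "coeffwise_nonneg (minor (A \<star> B) r i j)"
    using assms(1) coeffwise_totally_positiveD[OF assms(2)] coeffwise_totally_positiveD[OF assms(3)]
    by (intro coeffwise_nonneg_minor_row_mult) auto
qed

section \<open>Production matrices\<close>

text \<open>Induction on the size of the minor, then on its first row index. If that index is 0, the
  unit row peels off; otherwise all row indices drop by one, and \<open>step\<close> reduces to the
  minors with the lowered rows and arbitrary columns.\<close>

lemma coeffwise_totally_positive_by_rows:
  assumes first: "A 0 0 = 1" "\<And>k. 0 < k \<Longrightarrow> A 0 k = 0"
    and step: "\<And>r i j. strict_mono_on {..<r} i \<Longrightarrow> strict_mono_on {..<r} j \<Longrightarrow>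
      (\<And>g. strict_mono_on {..<r} g \<Longrightarrow> coeffwise_nonneg (minor A r i g)) \<Longrightarrow>
      coeffwise_nonneg (minor (\<lambda>n. A (Suc n)) r i j)"
  shows "coeffwise_totally_positive A"
proof (rule coeffwise_totally_positiveI)
  show "coeffwise_nonneg (minor A r i j)"
    if "strict_mono_on {..<r} i" "strict_mono_on {..<r} j" for r i j
    using that
  proof (induction r arbitrary: i j)
    case (Suc r)
    show ?case
      using Suc.prems
    proof (induction "i 0" arbitrary: i j)
      case 0
      have "A (i 0) (j q) = 0" if "0 < q" "q \<le> r" for q
        using strict_mono_on_lessThan_Suc_first[OF 0(3) that] 0(1) by (simp add: first)
      then have "minor A (Suc r) i j
          = A 0 (j 0) * minor A r (\<lambda>p. i (Suc p)) (\<lambda>q. j (Suc q))"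
        using 0(1) by (simp add: minor_expand_first_row)
      moreover have "coeffwise_nonneg (A 0 (j 0))"
        using first by (cases "j 0") auto
      ultimately show ?case
        using 0 by (simp add: coeffwise_nonneg_mult Suc.IH strict_mono_on_lessThan_Suc_shift)
    next
      case (Suc c)
      have pos: "0 < i p" if "p < Suc r" for p
        using strict_mono_on_lessThan_Suc_first[OF Suc(3), of p] Suc(2) that by (cases p) auto
      have mono: "strict_mono_on {..<Suc r} (\<lambda>p. i p - 1)"
      proof (rule strict_mono_onI)
        fix p q assume "p \<in> {..<Suc r}" "q \<in> {..<Suc r}" "p < q"
        then show "i p - 1 < i q - 1"
          using strict_mono_onD[OF Suc(3), of p q] pos[of p] by simp
      qed
      have "minor A (Suc r) i j = minor (\<lambda>n. A (Suc n)) (Suc r) (\<lambda>p. i p - 1) j"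
        using pos by (intro minor_cong) auto
      also have "coeffwise_nonneg \<dots>"
        using Suc(2) by (intro step mono Suc(4) Suc(1)) auto
      finally show ?case .
    qed
  qed simp
qed

text \<open>\<open>A\<close> is the output matrix of the production matrix \<open>P\<close>: its row
  \<open>n\<close> is the zeroth row of the \<open>n\<close>-th power of \<open>P\<close>.\<close>

lemma coeffwise_totally_positive_output_matrix:
  assumes "row_finite A" "coeffwise_totally_positive P"
    and "A 0 0 = 1" "\<And>k. 0 < k \<Longrightarrow> A 0 k = 0" "(\<lambda>n. A (Suc n)) = A \<star> P"
  shows "coeffwise_totally_positive A"
  using assms(3,4)
proof (rule coeffwise_totally_positive_by_rows)
  fix r and i j :: "nat \<Rightarrow> nat"
  assume "strict_mono_on {..<r} i" "strict_mono_on {..<r} j"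
    and "\<And>g. strict_mono_on {..<r} g \<Longrightarrow> coeffwise_nonneg (minor A r i g)"
  then show "coeffwise_nonneg (minor (\<lambda>n. A (Suc n)) r i j)"
    unfolding assms(5) using assms(1)
    by (intro coeffwise_nonneg_minor_row_mult coeffwise_totally_positiveD[OF assms(2)])
qed

text \<open>\<open>krylov P n\<close> is the zeroth column of the \<open>n\<close>-th power of
  \<open>P\<close>, the Krylov vector of \<open>P\<close> started at the zeroth unit vector.\<close>

primrec krylov :: "(nat \<Rightarrow> nat \<Rightarrow> 'a::semiring_1) \<Rightarrow> nat \<Rightarrow> nat \<Rightarrow> 'a" where
  "krylov P 0 = (\<lambda>k. if k = 0 then 1 else 0)"
| "krylov P (Suc n) = (\<lambda>k. \<Sum>m | P k m \<noteq> 0. P k m * krylov P n m)"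

lemma krylov_Suc: "(\<lambda>k n. krylov P (Suc n) k) = P \<star> (\<lambda>k n. krylov P n k)"
  by (simp add: row_mult_def)

text \<open>The row induction runs over the exponent \<open>n\<close>. As \<open>P\<close> acts from
  the left, the minor is transposed first, and the induction hypothesis then concerns the right
  factor.\<close>

lemma coeffwise_totally_positive_krylov:
  assumes "row_finite P" "coeffwise_totally_positive P"
  shows "coeffwise_totally_positive (\<lambda>k n. krylov P n k)"
proof -
  have tp: "coeffwise_totally_positive (krylov P)"
  proof (rule coeffwise_totally_positive_by_rows)
    fix r and i j :: "nat \<Rightarrow> nat"
    assume i: "strict_mono_on {..<r} i" and j: "strict_mono_on {..<r} j"
      and *: "\<And>g. strict_mono_on {..<r} g \<Longrightarrow> coeffwise_nonneg (minor (krylov P) r i g)"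
    have "minor (\<lambda>n. krylov P (Suc n)) r i j = minor (\<lambda>k n. krylov P (Suc n) k) r j i"
      by (rule minor_transpose[symmetric])
    also have "coeffwise_nonneg \<dots>"
      unfolding krylov_Suc using assms(1) j *
      by (intro coeffwise_nonneg_minor_row_mult coeffwise_totally_positiveD[OF assms(2)])
        (auto simp: minor_transpose[of "krylov P"])
    finally show "coeffwise_nonneg (minor (\<lambda>n. krylov P (Suc n)) r i j)" .
  qed auto
  show ?thesis
    using coeffwise_totally_positiveD[OF tp]
    by (intro coeffwise_totally_positiveI) (simp add: minor_transpose[of "krylov P"])
qed

lemma coeffwise_hankel_totally_positive_production:
  assumes R: "row_finite R" "R 0 0 = 1" "\<And>k. 0 < k \<Longrightarrow> R 0 k = 0" "(\<lambda>n. R (Suc n)) = R \<star> P"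
    and P: "row_finite P" "coeffwise_totally_positive P"
  shows "coeffwise_hankel_totally_positive (\<lambda>n. R n 0)"
proof -
  let ?K = "\<lambda>k n. krylov P n k"
  \<comment> \<open>Induction on \<open>l\<close>: associativity moves one factor \<open>P\<close>
    from the column vector to the row of \<open>R\<close>.\<close>
  have "(R \<star> ?K) n l = R (n + l) 0" for n l
  proof (induction l arbitrary: n)
    case 0
    \<comment> \<open>Index 0 is adjoined because \<open>R n 0\<close> may vanish.\<close>
    have "(R \<star> ?K) n 0 = (\<Sum>m\<in>insert 0 {m. R n m \<noteq> 0}. R n m * krylov P 0 m)"
      using R(1) by (intro row_mult_eq_sum) (auto simp: row_finite_def)
    also have "\<dots> = (\<Sum>m\<in>{0}. R n m * krylov P 0 m)"
      using R(1) by (intro sum.mono_neutral_right) (auto simp: row_finite_def)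
    finally show ?case
      by simp
  next
    case (Suc l)
    have "(R \<star> ?K) n (Suc l) = (R \<star> (\<lambda>k n. krylov P (Suc n) k)) n l"
      by (simp add: row_mult_def)
    also have "\<dots> = (R \<star> P \<star> ?K) n l"
      unfolding krylov_Suc by (simp add: row_mult_assoc R P)
    also have "\<dots> = (R \<star> ?K) (Suc n) l"
      unfolding R(4)[symmetric] by (simp add: row_mult_def)
    finally show ?case
      by (simp add: Suc.IH)
  qed
  then have "hankel_matrix (\<lambda>n. R n 0) = R \<star> ?K"
    by (simp add: hankel_matrix_def fun_eq_iff)
  then show ?thesis
    unfolding coeffwise_hankel_totally_positive_def
    using coeffwise_totally_positive_output_matrix[OF R(1) P(2) R(2-4)] R(1) P
    by (simp add: coeffwise_totally_positive_row_mult coeffwise_totally_positive_krylov)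
qed

section \<open>Three totally positive matrices\<close>

definition bidiagonal :: "'a \<Rightarrow> 'a \<Rightarrow> nat \<Rightarrow> nat \<Rightarrow> 'a::zero" where
  "bidiagonal d e n k = (if k = n then d else if k = Suc n then e else 0)"

lemma row_finite_bidiagonal: "row_finite (bidiagonal d e)"
  by (rule row_finiteI[of Suc]) (simp add: bidiagonal_def)

text \<open>The corner always peels off: if \<open>j 0 \<le> i 0\<close>, the later rows meet column
  \<open>j 0\<close> below the diagonal; otherwise the later columns meet row \<open>i 0\<close>
  beyond the superdiagonal.\<close>

lemma coeffwise_totally_positive_bidiagonal:
  assumes "coeffwise_nonneg d" "coeffwise_nonneg e"
  shows "coeffwise_totally_positive (bidiagonal d e)"
proof (rule coeffwise_totally_positiveI)
  show "coeffwise_nonneg (minor (bidiagonal d e) r i j)"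
    if "strict_mono_on {..<r} i" "strict_mono_on {..<r} j" for r i j
    using that
  proof (induction r arbitrary: i j)
    case (Suc r)
    have i: "i 0 < i p" and j: "j 0 < j p" if "0 < p" "p \<le> r" for p
      using Suc.prems that by (auto intro: strict_mono_on_lessThan_Suc_first)
    have "minor (bidiagonal d e) (Suc r) i j = bidiagonal d e (i 0) (j 0) *
        minor (bidiagonal d e) r (\<lambda>p. i (Suc p)) (\<lambda>q. j (Suc q))"
    proof (cases "j 0 \<le> i 0")
      case True
      have "bidiagonal d e (i p) (j 0) = 0" if "0 < p" "p \<le> r" for p
        using i[OF that] True by (simp add: bidiagonal_def)
      then show ?thesis
        by (rule minor_expand_first_col)
    next
      case False
      have "bidiagonal d e (i 0) (j q) = 0" if "0 < q" "q \<le> r" for q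
        using j[OF that] False by (simp add: bidiagonal_def)
      then show ?thesis
        by (rule minor_expand_first_row)
    qed
    moreover have "coeffwise_nonneg (bidiagonal d e (i 0) (j 0))"
      using assms by (simp add: bidiagonal_def)
    ultimately show ?case
      by (simp add: coeffwise_nonneg_mult Suc.IH strict_mono_on_lessThan_Suc_shift Suc.prems)
  qed simp
qed

lemma row_mult_bidiagonal:
  fixes A :: "nat \<Rightarrow> nat \<Rightarrow> 'a::semiring_0"
  assumes "row_finite A"
  shows "(A \<star> bidiagonal d e) n k = A n k * d + (case k of 0 \<Rightarrow> 0 | Suc l \<Rightarrow> A n l * e)"
proof -
  \<comment> \<open>Column \<open>k\<close> is supported in rows \<open>k\<close> and
    \<open>k - 1\<close>; for \<open>k = 0\<close> the two coincide by truncated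
    subtraction.\<close>
  let ?S = "{k, k - 1} \<union> {m. A n m \<noteq> 0}"
  have "(A \<star> bidiagonal d e) n k = (\<Sum>m\<in>?S. A n m * bidiagonal d e m k)"
    using assms by (intro row_mult_eq_sum) (auto simp: row_finite_def)
  also have "\<dots> = (\<Sum>m\<in>{k, k - 1}. A n m * bidiagonal d e m k)"
    using assms by (intro sum.mono_neutral_right) (auto simp: row_finite_def bidiagonal_def)
  finally show ?thesis
    by (cases k) (auto simp: bidiagonal_def)
qed

definition binomial_matrix :: "nat \<Rightarrow> nat \<Rightarrow> 'a::semiring_1" where
  "binomial_matrix n k = of_nat (n choose k)"

lemma row_finite_binomial_matrix: "row_finite binomial_matrix"
  by (rule row_finiteI[of id]) (simp add: binomial_matrix_def binomial_eq_0)

text \<open>Pascal's rule says that the binomial matrix is the output matrix of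
  \<open>bidiagonal 1 1\<close>.\<close>

lemma coeffwise_totally_positive_binomial_matrix: "coeffwise_totally_positive binomial_matrix"
proof (rule coeffwise_totally_positive_output_matrix)
  show "(\<lambda>n. binomial_matrix (Suc n) :: nat \<Rightarrow> 'a poly) = binomial_matrix \<star> bidiagonal 1 1"
    by (auto simp: fun_eq_iff row_mult_bidiagonal row_finite_binomial_matrix binomial_matrix_def
        split: nat.split)
qed (auto simp: binomial_matrix_def row_finite_binomial_matrix coeffwise_totally_positive_bidiagonal)

text \<open>The quotient \<open>m! / k!\<close> is written as a product, to make sense without
  division.\<close>

definition fact_quotient_matrix :: "nat \<Rightarrow> nat \<Rightarrow> 'a::comm_semiring_1" where
  "fact_quotient_matrix m k = (if k \<le> m then of_nat (\<Prod>{Suc k..m}) else 0)"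

lemma fact_quotient_matrix_Suc:
  "k \<le> m \<Longrightarrow> fact_quotient_matrix (Suc m) k = of_nat (Suc m) * fact_quotient_matrix m k"
  by (simp add: fact_quotient_matrix_def prod.nat_ivl_Suc' algebra_simps)

lemma fact_quotient_matrix_diag [simp]: "fact_quotient_matrix m m = 1"
  by (simp add: fact_quotient_matrix_def)

text \<open>Makes columns \<open>k\<close> and \<open>l\<close> proportional on all rows from
  \<open>l\<close> on.\<close>

lemma fact_quotient_matrix_trans:
  "k \<le> l \<Longrightarrow> l \<le> m \<Longrightarrow>
    fact_quotient_matrix m k = fact_quotient_matrix l k * fact_quotient_matrix m l"
  by (induction m) (auto simp: le_Suc_eq fact_quotient_matrix_Suc mult_ac simp del: of_nat_Suc)

lemma row_finite_fact_quotient_matrix: "row_finite fact_quotient_matrix"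
  by (rule row_finiteI[of id]) (simp add: fact_quotient_matrix_def)

text \<open>If \<open>j 1 \<le> i 0\<close>, the first two columns of the minor are proportional and
  it vanishes. Otherwise lower triangularity leaves only the corner in the first row, and it peels
  off.\<close>

lemma coeffwise_totally_positive_fact_quotient_matrix:
  "coeffwise_totally_positive (fact_quotient_matrix :: nat \<Rightarrow> nat \<Rightarrow> 'a::linordered_idom poly)"
proof (rule coeffwise_totally_positiveI)
  show "coeffwise_nonneg (minor (fact_quotient_matrix :: nat \<Rightarrow> nat \<Rightarrow> 'a poly) r i j)"
    if "strict_mono_on {..<r} i" "strict_mono_on {..<r} j" for r i j
    using that
  proof (induction r arbitrary: i j)
    case (Suc r)
    have i: "i 0 < i p" and j: "j 0 < j p" if "0 < p" "p \<le> r" for p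
      using Suc.prems that by (auto intro: strict_mono_on_lessThan_Suc_first)
    show ?case
    proof (cases "0 < r \<and> j 1 \<le> i 0")
      case True
      have "fact_quotient_matrix (i p) (j 0)
          = (fact_quotient_matrix (j 1) (j 0) * fact_quotient_matrix (i p) (j 1) :: 'a poly)"
        if "p < Suc r" for p
        using True i[of p] j[of 1] that by (intro fact_quotient_matrix_trans) (cases p; auto)+
      then have "minor (fact_quotient_matrix :: nat \<Rightarrow> nat \<Rightarrow> 'a poly) (Suc r) i j = 0"
        using True by (intro minor_eq_0_if_proportional_cols[where k = 0 and l = 1]) auto
      then show ?thesis
        by simp
    next
      case False
      have "i 0 < j q" if q: "0 < q" "q \<le> r" for q
      proof -
        have "j 1 \<le> j q"
          using q strict_mono_onD[OF Suc.prems(2), of 1 q] by (cases "q = 1") auto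
        then show ?thesis
          using False q by auto
      qed
      then have "minor (fact_quotient_matrix :: nat \<Rightarrow> nat \<Rightarrow> 'a poly) (Suc r) i j
        = fact_quotient_matrix (i 0) (j 0) *
          minor fact_quotient_matrix r (\<lambda>p. i (Suc p)) (\<lambda>q. j (Suc q))"
        by (intro minor_expand_first_row) (simp add: fact_quotient_matrix_def not_le)
      moreover have "coeffwise_nonneg (fact_quotient_matrix (i 0) (j 0) :: 'a poly)"
        by (simp add: fact_quotient_matrix_def del: of_nat_prod)
      ultimately show ?thesis
        by (simp add: coeffwise_nonneg_mult Suc.IH strict_mono_on_lessThan_Suc_shift Suc.prems)
    qed
  qed simp
qed

text \<open>The matrix of factorial quotients inverts the bidiagonal matrix with 1 on the diagonal and
  \<open>- (m + 1)\<close> in position \<open>(m + 1, m)\<close>, so this sum telescopes.\<close>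

lemma sum_fact_quotient_matrix_telescope:
  fixes f :: "nat \<Rightarrow> 'a::comm_ring_1"
  assumes "f (Suc N) = 0"
  shows "(\<Sum>m\<le>N. (f m - of_nat (Suc m) * f (Suc m)) * fact_quotient_matrix m k)
    = (if k \<le> N then f k else 0)"
proof -
  \<comment> \<open>Partial sums carry a boundary term in \<open>f (Suc M)\<close>, which the
    assumption removes at \<open>M = N\<close>.\<close>
  have "(\<Sum>m\<le>M. (f m - of_nat (Suc m) * f (Suc m)) * fact_quotient_matrix m k)
      = (if k \<le> M then f k - of_nat (Suc M) * f (Suc M) * fact_quotient_matrix M k else 0)" for M
  proof (induction M)
    case (Suc M)
    consider "k \<le> M" | "k = Suc M" | "Suc M < k"
      by linarith
    then show ?case
    proof cases
      case 1
      then show ?thesis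
        using Suc by (simp add: fact_quotient_matrix_Suc algebra_simps)
    next
      case 2
      then show ?thesis
        using Suc by simp
    next
      case 3
      then show ?thesis
        using Suc by (simp add: fact_quotient_matrix_def)
    qed
  qed (auto simp: fact_quotient_matrix_def)
  then show ?thesis
    using assms by simp
qed

section \<open>The polynomials \<open>(x + n)\<^sup>n\<close>\<close>

text \<open>Row \<open>n\<close> lists the coefficients in \<open>y\<close> of
  \<open>(x + y + n)^n\<close>, with \<open>[:0, 1:]\<close> as \<open>x\<close>.\<close>

definition tree_matrix :: "nat \<Rightarrow> nat \<Rightarrow> 'a::comm_semiring_1 poly" where
  "tree_matrix n k = of_nat (n choose k) * ([:0, 1:] + of_nat n) ^ (n - k)"

definition tree_production_matrix :: "nat \<Rightarrow> nat \<Rightarrow> 'a::comm_semiring_1 poly" where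
  "tree_production_matrix = binomial_matrix \<star> bidiagonal [:0, 1:] 1 \<star> fact_quotient_matrix"

lemma row_finite_tree_matrix: "row_finite tree_matrix"
  by (rule row_finiteI[of id]) (simp add: tree_matrix_def binomial_eq_0)

text \<open>The substitution of \<open>y + 1\<close> for \<open>y\<close>, read off on coefficients
  through trinomial revision and the binomial theorem.\<close>

lemma tree_matrix_mult_binomial_matrix:
  "(tree_matrix \<star> binomial_matrix) n k
    = of_nat (n choose k) * ([:0, 1:] + of_nat (Suc n)) ^ (n - k)"
proof (cases "k \<le> n")
  case True
  let ?y = "[:0, 1:] + of_nat n :: 'a poly"
  have "(tree_matrix \<star> binomial_matrix) n k = (\<Sum>m\<in>{k..n}. tree_matrix n m * binomial_matrix m k)"
    by (subst row_mult_eq_sum[of "{..n}"])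
      (auto simp: tree_matrix_def binomial_matrix_def binomial_eq_0 not_le
        intro!: sum.mono_neutral_right)
  also have "\<dots> = (\<Sum>l\<le>n - k. tree_matrix n (k + l) * binomial_matrix (k + l) k)"
    using True by (intro sum.reindex_bij_witness[of _ "\<lambda>l. k + l" "\<lambda>m. m - k"]) auto
  also have "\<dots> = (\<Sum>l\<le>n - k. of_nat (n choose k) * (of_nat (n - k choose l) * ?y ^ (n - k - l)))"
  proof (rule sum.cong[OF refl])
    fix l assume "l \<in> {..n - k}"
    then have "(n choose (k + l)) * (k + l choose k) = (n choose k) * (n - k choose l)"
      using True choose_mult[of k "k + l" n] by simp
    then have "of_nat (n choose (k + l)) * of_nat (k + l choose k)
        = (of_nat (n choose k) * of_nat (n - k choose l) :: 'a poly)"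
      by (metis of_nat_mult)
    moreover have "tree_matrix n (k + l) * binomial_matrix (k + l) k
        = of_nat (n choose (k + l)) * of_nat (k + l choose k) * ?y ^ (n - k - l)"
      by (simp add: tree_matrix_def binomial_matrix_def mult_ac)
    ultimately show "tree_matrix n (k + l) * binomial_matrix (k + l) k
        = of_nat (n choose k) * (of_nat (n - k choose l) * ?y ^ (n - k - l))"
      by (simp add: mult.assoc)
  qed
  also have "\<dots> = of_nat (n choose k) * (1 + ?y) ^ (n - k)"
    by (simp add: binomial_ring sum_distrib_left)
  finally show ?thesis
    by (simp add: add_ac)
next
  case False
  then show ?thesis
    by (subst row_mult_eq_sum[of "{..n}"])
      (auto simp: tree_matrix_def binomial_matrix_def binomial_eq_0)
qed

text \<open>Both sides are the coefficient of \<open>y^k\<close> in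
  \<open>(x + y) (x + y + n + 1)^n\<close>; the right side reads it as \<open>(1 - d/dy)\<close>
  applied to \<open>(x + y + n + 1)^(n + 1)\<close>.\<close>

lemma tree_matrix_mult_binomial_bidiagonal:
  "(tree_matrix \<star> binomial_matrix \<star> bidiagonal [:0, 1:] 1) n k
    = tree_matrix (Suc n) k - of_nat (Suc k) * (tree_matrix (Suc n) (Suc k) :: 'a::comm_ring_1 poly)"
proof -
  define z where "z = ([:0, 1:] + of_nat (Suc n) :: 'a poly)"
  \<comment> \<open>Eliminating \<open>x\<close> leaves only powers of \<open>z\<close>: Pascal's
    rule merges the leading terms, and \<open>absorb\<close> rewrites the remaining one.\<close>
  have x: "[:0, 1:] = z - of_nat (Suc n)"
    by (simp add: z_def)
  have absorb: "of_nat (Suc k) * of_nat (Suc n choose Suc k)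
      = (of_nat (Suc n) * of_nat (n choose k) :: 'a poly)"
    by (metis Suc_times_binomial_eq mult.commute of_nat_mult)
  have "(tree_matrix \<star> binomial_matrix \<star> bidiagonal [:0, 1:] 1) n k
      = of_nat (n choose k) * z ^ (n - k) * (z - of_nat (Suc n))
        + (case k of 0 \<Rightarrow> 0 | Suc l \<Rightarrow> of_nat (n choose l) * z ^ (n - l))"
    by (subst row_mult_bidiagonal)
      (simp_all add: row_finite_row_mult row_finite_tree_matrix row_finite_binomial_matrix
        tree_matrix_mult_binomial_matrix flip: x z_def split: nat.split del: of_nat_Suc)
  also have "\<dots> = of_nat (Suc n choose k) * z ^ (Suc n - k)
      - of_nat (Suc n) * of_nat (n choose k) * z ^ (n - k)"
  proof (cases k)
    case (Suc l)
    show ?thesis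
    proof (cases "k \<le> n")
      case True
      then have "n - l = Suc (n - k)" "Suc n - k = Suc (n - k)"
        using Suc by auto
      then show ?thesis
        using Suc by (simp add: algebra_simps)
    qed (use Suc in \<open>simp add: binomial_eq_0\<close>)
  qed (simp add: algebra_simps)
  finally show ?thesis
    unfolding absorb[symmetric] by (simp add: tree_matrix_def z_def mult_ac del: of_nat_Suc)
qed

lemma tree_matrix_production:
  "(\<lambda>n. tree_matrix (Suc n) :: nat \<Rightarrow> 'a::comm_ring_1 poly) = tree_matrix \<star> tree_production_matrix"
proof (intro ext)
  fix n k
  let ?f = "tree_matrix (Suc n) :: nat \<Rightarrow> 'a poly"
  have "(tree_matrix \<star> tree_production_matrix) n k
      = (tree_matrix \<star> binomial_matrix \<star> bidiagonal [:0, 1:] 1 \<star> fact_quotient_matrix) n k"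
    by (simp add: tree_production_matrix_def row_mult_assoc row_finite_row_mult
        row_finite_tree_matrix row_finite_binomial_matrix row_finite_bidiagonal)
  \<comment> \<open>Multiplication by \<open>x + y\<close> raises the degree in \<open>y\<close> to
    \<open>n + 1\<close>, so the sum ends at \<open>Suc n\<close>; the next entry of
    \<open>?f\<close> is 0, as the telescoping requires.\<close>
  also have "\<dots> = (\<Sum>m\<le>Suc n. (?f m - of_nat (Suc m) * ?f (Suc m)) * fact_quotient_matrix m k)"
    unfolding tree_matrix_mult_binomial_bidiagonal[symmetric]
  proof (rule row_mult_eq_sum)
    fix m assume "m \<notin> {..Suc n}"
    then show "(tree_matrix \<star> binomial_matrix \<star> bidiagonal [:0, 1:] 1) n m = (0 :: 'a poly)"
      unfolding tree_matrix_mult_binomial_bidiagonal by (simp add: tree_matrix_def binomial_eq_0)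
  qed simp
  also have "\<dots> = (if k \<le> Suc n then ?f k else 0)"
    by (rule sum_fact_quotient_matrix_telescope) (simp add: tree_matrix_def binomial_eq_0)
  also have "\<dots> = ?f k"
    by (simp add: tree_matrix_def binomial_eq_0)
  finally show "?f k = (tree_matrix \<star> tree_production_matrix) n k"
    by simp
qed

theorem theorem1p2:
  shows "coeffwise_hankel_totally_positive (\<lambda>n. map_poly real_of_int (T n))"
proof -
  have "map_poly real_of_int (T n) = tree_matrix n 0" for n
  proof -
    have "map_poly real_of_int (T n)
        = (\<Sum>k\<le>n. monom (of_nat (n choose k) * of_nat n ^ (n - k)) k)"
      by (rule poly_eqI) (simp add: coeff_map_poly coeff_sum T_def)
    also have "\<dots> = (monom 1 1 + of_nat n) ^ n"
    proof -
      have "(of_nat m :: real poly) ^ j = monom (of_nat m ^ j) 0" for m j :: nat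
        by (simp add: of_nat_poly poly_const_pow monom_0)
      then show ?thesis
        unfolding binomial_ring
        by (intro sum.cong) (simp_all add: monom_power of_nat_monom mult_monom)
    qed
    finally show ?thesis
      by (simp add: tree_matrix_def monom_altdef)
  qed
  moreover have "coeffwise_hankel_totally_positive (\<lambda>n. tree_matrix n 0 :: real poly)"
  proof (rule coeffwise_hankel_totally_positive_production)
    show "row_finite (tree_production_matrix :: nat \<Rightarrow> nat \<Rightarrow> real poly)"
      by (simp add: tree_production_matrix_def row_finite_row_mult row_finite_binomial_matrix
          row_finite_bidiagonal row_finite_fact_quotient_matrix)
    have "coeffwise_nonneg [:0, 1 :: real:]"
      by (simp add: coeffwise_nonneg_def coeff_pCons split: nat.split)
    then show "coeffwise_totally_positive (tree_production_matrix :: nat \<Rightarrow> nat \<Rightarrow> real poly)"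
      by (simp add: tree_production_matrix_def coeffwise_totally_positive_row_mult
          row_finite_row_mult row_finite_binomial_matrix row_finite_bidiagonal
          coeffwise_totally_positive_binomial_matrix coeffwise_totally_positive_bidiagonal
          coeffwise_totally_positive_fact_quotient_matrix)
  \<comment> \<open>Row 0 encodes the constant polynomial 1, so it is the required unit row.\<close>
  qed (rule row_finite_tree_matrix tree_matrix_production | simp add: tree_matrix_def)+
  ultimately show ?thesis
    by simp
qed

end
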